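(* Let $H$ be a separable Hilbert space, $C,C'\in GL(H)$, let $W=\{(W_i,v_i)\}_{i\in I}$ be a $CC'$-controlled fusion frame for $H$, and let $\tilde W=\{(\tilde W_i,z_i)\}_{i\in I}$ be a $Q$-dual $CC'$-controlled fusion frame of $W$, with $Q:\mathcal{K}_{2,\tilde W}\to\mathcal{K}_{2,W}$ a bounded linear operator. Then the following conditions are equivalent: 1. $T_{\tilde W}^*Q^*T_W=I_H$; 2. $T_W^*QT_{\tilde W}=I_H$; 3. $\langle f,g\rangle=\langle Q^*T_Wf,T_{\tilde W}g\rangle=\langle QT_{\tilde W}f,T_Wg\rangle$ for all $f,g\in H$.
   Context: $I$ is an index set. $GL(H)$ is the set of bounded linear operators on $H$ having a bounded inverse; $I_H$ is the identity operator on $H$; $\pi_V$ is the orthogonal projection of $H$ onto a closed subspace $V$. Let $\{W_i\}_{i\in I}$ be closed subspaces of $H$ and $v_i>0$ real numbers (weights). $W=\{(W_i,v_i)\}_{i\in I}$ is a $CC'$-controlled fusion frame for $H$ if there exist $0<A\le B<\infty$ with $A\|f\|^2\le\sum_{i\in I}v_i^2\langle\pi_{W_i}C'f,\pi_{W_i}Cf\rangle\le B\|f\|^2$ for all $f\in H$; it is a $CC'$-controlled Bessel fusion sequence if only the second inequality is required. Put $\mathcal{K}_{2,W}=\big\{\{v_i(C^*\pi_{W_i}C')^{1/2}f\}_{i\in I}:f\in H\big\}\subset(\bigoplus_{i\in I}H)_{\ell^2}$ (the Hilbert space of square-summable families in $H$), where $(C^*\pi_{W_i}C')^{1/2}$ denotes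 a square root of the operator $C^*\pi_{W_i}C'$, written without any further hypothesis. Let $T_W:H\to\mathcal{K}_{2,W}$, $T_Wf=\{v_i(C^*\pi_{W_i}C')^{1/2}f\}_{i\in I}$, with adjoint $T_W^*:\mathcal{K}_{2,W}\to H$, $T_W^*(\{v_i(C^*\pi_{W_i}C')^{1/2}f\}_{i\in I})=\sum_{i\in I}v_i^2C^*\pi_{W_i}C'f$. The same notation is used for $\tilde W$ with weights $z_i>0$. A $CC'$-controlled Bessel fusion sequence $\tilde W=\{(\tilde W_i,z_i)\}_{i\in I}$ is called a $Q$-dual $CC'$-controlled fusion frame of $W$ if there exists a bounded linear operator $Q:\mathcal{K}_{2,\tilde W}\to\mathcal{K}_{2,W}$ such that $T_W^*QT_{\tilde W}=I_H$. *)

theory Defs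
  imports "HOL-Analysis.Analysis"
begin

(* The scalar field of a Hilbert space. A complete real normed field is isomorphic to the reals or
   to the complex numbers (Gelfand-Mazur), and the axioms force sconj to be the identity or the
   complex conjugation respectively; so this class means "real or complex scalars". *)
class rc_field = real_normed_field + banach +
  fixes sconj :: "'a \<Rightarrow> 'a"
  assumes conj_add: "sconj (a + b) = sconj a + sconj b"
    and conj_mult: "sconj (a * b) = sconj a * sconj b"
    and conj_conj: "sconj (sconj a) = a"
    and mult_conj: "a * sconj a = ((norm a)\<^sup>2) *\<^sub>R 1"

instantiation real :: rc_field
begin
definition sconj_real :: "real \<Rightarrow> real" where "sconj_real a = a"
instance by standard (simp_all add: sconj_real_def power2_eq_square)
end

instantiation complex :: rc_field
begin
definition sconj_complex :: "complex \<Rightarrow> complex" where "sconj_complex = cnj"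
instance by standard
  (simp_all add: sconj_complex_def scaleR_conv_of_real complex_norm_square del: of_real_power)
end

(* Completeness of H is the sort constraint banach. The inner product is linear in its first
   argument; positive definiteness follows from ip_self. *)
locale hilbert_space = vector_space smul
  for smul :: "'k::rc_field \<Rightarrow> 'h::banach \<Rightarrow> 'h" +
  fixes ip :: "'h \<Rightarrow> 'h \<Rightarrow> 'k"
  assumes smul_of_real: "smul (of_real r) x = r *\<^sub>R x"
    and ip_add_left: "ip (x + y) u = ip x u + ip y u"
    and ip_smul_left: "ip (smul c x) u = c * ip x u"
    and ip_commute: "ip x u = sconj (ip u x)"
    and ip_self: "ip x x = of_real ((norm x)\<^sup>2)"

lemma hilbert_space_real:
  "hilbert_space (*\<^sub>R) (inner :: 'h::{real_inner, banach} \<Rightarrow> 'h \<Rightarrow> real)"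
  by unfold_locales
    (auto simp: algebra_simps inner_commute sconj_real_def power2_norm_eq_inner)

lemma hilbert_space_complex:
  "hilbert_space (*) (\<lambda>x y :: complex. x * cnj y)"
  by unfold_locales
    (auto simp: algebra_simps sconj_complex_def complex_norm_square scaleR_conv_of_real
      simp del: of_real_power)

definition bounded_op :: "('k::rc_field \<Rightarrow> 'h::banach \<Rightarrow> 'h) \<Rightarrow> ('h \<Rightarrow> 'h) \<Rightarrow> bool" where
  "bounded_op smul T \<longleftrightarrow> bounded_linear T \<and> (\<forall>c x. T (smul c x) = smul c (T x))"

definition GL :: "('k::rc_field \<Rightarrow> 'h::banach \<Rightarrow> 'h) \<Rightarrow> ('h \<Rightarrow> 'h) set" where
  "GL smul = {T. bounded_op smul T \<and> (\<exists>S. bounded_op smul S \<and> S \<circ> T = id \<and> T \<circ> S = id)}"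

(* Adjoint of T : X -> Y, where X and Y carry the inner products ipX and ipY. Only X has to be
   given, since it is where the values of the adjoint are sought; the description is proper
   whenever X is complete and T is bounded. *)
definition adjoint_on ::
  "'a set \<Rightarrow> ('a \<Rightarrow> 'a \<Rightarrow> 'k) \<Rightarrow> ('b \<Rightarrow> 'b \<Rightarrow> 'k) \<Rightarrow> ('a \<Rightarrow> 'b) \<Rightarrow> 'b \<Rightarrow> 'a" where
  "adjoint_on X ipX ipY T y = (THE x'. x' \<in> X \<and> (\<forall>x\<in>X. ipY (T x) y = ipX x x'))"

definition orth_proj :: "('h::banach \<Rightarrow> 'h \<Rightarrow> 'k::rc_field) \<Rightarrow> 'h set \<Rightarrow> 'h \<Rightarrow> 'h" where
  "orth_proj ip V f = (THE p. p \<in> V \<and> (\<forall>u\<in>V. ip (f - p) u = 0))"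

(* Families indexed by I are functions vanishing outside I, so that equality of families is
   equality of functions. *)
definition ell2 :: "'i set \<Rightarrow> ('i \<Rightarrow> 'h::banach) set" where
  "ell2 I = {x. (\<forall>i. i \<notin> I \<longrightarrow> x i = 0) \<and> (\<lambda>i. (norm (x i))\<^sup>2) summable_on I}"

definition ell2_ip ::
  "('h::banach \<Rightarrow> 'h \<Rightarrow> 'k::rc_field) \<Rightarrow> 'i set \<Rightarrow> ('i \<Rightarrow> 'h) \<Rightarrow> ('i \<Rightarrow> 'h) \<Rightarrow> 'k" where
  "ell2_ip ip I x y = (\<Sum>\<^sub>\<infinity>i\<in>I. ip (x i) (y i))"

definition ell2_norm :: "'i set \<Rightarrow> ('i \<Rightarrow> 'h::banach) \<Rightarrow> real" where
  "ell2_norm I x = sqrt (\<Sum>\<^sub>\<infinity>i\<in>I. (norm (x i))\<^sup>2)"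

definition ell2_bounded_op ::
  "('k::rc_field \<Rightarrow> 'h::banach \<Rightarrow> 'h) \<Rightarrow> 'i set \<Rightarrow> ('i \<Rightarrow> 'h) set \<Rightarrow> ('i \<Rightarrow> 'h) set
    \<Rightarrow> (('i \<Rightarrow> 'h) \<Rightarrow> ('i \<Rightarrow> 'h)) \<Rightarrow> bool" where
  "ell2_bounded_op smul I X Y Q \<longleftrightarrow>
     (\<forall>x\<in>X. Q x \<in> Y) \<and>
     (\<forall>x\<in>X. \<forall>y\<in>X. Q (\<lambda>i. x i + y i) = (\<lambda>i. Q x i + Q y i)) \<and>
     (\<forall>c. \<forall>x\<in>X. Q (\<lambda>i. smul c (x i)) = (\<lambda>i. smul c (Q x i))) \<and>
     (\<exists>M. \<forall>x\<in>X. ell2_norm I (Q x) \<le> M * ell2_norm I x)"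

definition weighted_subspaces ::
  "('k::rc_field \<Rightarrow> 'h::banach \<Rightarrow> 'h) \<Rightarrow> 'i set \<Rightarrow> ('i \<Rightarrow> 'h set) \<Rightarrow> ('i \<Rightarrow> real) \<Rightarrow> bool" where
  "weighted_subspaces smul I W v \<longleftrightarrow>
     (\<forall>i\<in>I. module.subspace smul (W i) \<and> closed (W i) \<and> 0 < v i)"

(* The terms of the sum need be neither nonnegative nor real. The sum converges unconditionally,
   and being bounded by real numbers it has to be real. *)
definition has_controlled_sum ::
  "('h::banach \<Rightarrow> 'h \<Rightarrow> 'k::rc_field) \<Rightarrow> ('h \<Rightarrow> 'h) \<Rightarrow> ('h \<Rightarrow> 'h)
    \<Rightarrow> 'i set \<Rightarrow> ('i \<Rightarrow> 'h set) \<Rightarrow> ('i \<Rightarrow> real) \<Rightarrow> 'h \<Rightarrow> real \<Rightarrow> bool" where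
  "has_controlled_sum ip C C' I W v f s \<longleftrightarrow>
     ((\<lambda>i. of_real ((v i)\<^sup>2) * ip (orth_proj ip (W i) (C' f)) (orth_proj ip (W i) (C f))) has_sum of_real s) I"

definition controlled_fusion_frame ::
  "('k::rc_field \<Rightarrow> 'h::banach \<Rightarrow> 'h) \<Rightarrow> ('h \<Rightarrow> 'h \<Rightarrow> 'k) \<Rightarrow> ('h \<Rightarrow> 'h) \<Rightarrow> ('h \<Rightarrow> 'h)
    \<Rightarrow> 'i set \<Rightarrow> ('i \<Rightarrow> 'h set) \<Rightarrow> ('i \<Rightarrow> real) \<Rightarrow> bool" where
  "controlled_fusion_frame smul ip C C' I W v \<longleftrightarrow>
     weighted_subspaces smul I W v \<and>
     (\<exists>A B. 0 < A \<and> A \<le> B \<and>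
        (\<forall>f. \<exists>s. has_controlled_sum ip C C' I W v f s \<and>
           A * (norm f)\<^sup>2 \<le> s \<and> s \<le> B * (norm f)\<^sup>2))"

definition controlled_Bessel_fusion_sequence ::
  "('k::rc_field \<Rightarrow> 'h::banach \<Rightarrow> 'h) \<Rightarrow> ('h \<Rightarrow> 'h \<Rightarrow> 'k) \<Rightarrow> ('h \<Rightarrow> 'h) \<Rightarrow> ('h \<Rightarrow> 'h)
    \<Rightarrow> 'i set \<Rightarrow> ('i \<Rightarrow> 'h set) \<Rightarrow> ('i \<Rightarrow> real) \<Rightarrow> bool" where
  "controlled_Bessel_fusion_sequence smul ip C C' I W v \<longleftrightarrow>
     weighted_subspaces smul I W v \<and>
     (\<exists>B>0. \<forall>f. \<exists>s. has_controlled_sum ip C C' I W v f s \<and> s \<le> B * (norm f)\<^sup>2)"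

definition analysis_op ::
  "'i set \<Rightarrow> ('i \<Rightarrow> real) \<Rightarrow> ('i \<Rightarrow> 'h \<Rightarrow> 'h::banach) \<Rightarrow> 'h \<Rightarrow> ('i \<Rightarrow> 'h)" where
  "analysis_op I v R f = (\<lambda>i. if i \<in> I then v i *\<^sub>R R i f else 0)"

definition K2 :: "'i set \<Rightarrow> ('i \<Rightarrow> real) \<Rightarrow> ('i \<Rightarrow> 'h \<Rightarrow> 'h::banach) \<Rightarrow> ('i \<Rightarrow> 'h) set" where
  "K2 I v R = range (analysis_op I v R)"

(* R i is a square root of C* pi_{W i} C'. Neither that operator nor its root is assumed to be
   positive or self-adjoint, so the root is not determined by the operator. The inclusion of
   K2 in the l2 sum is part of the meaning of K2; for self-adjoint roots it follows
   from the Bessel condition, for arbitrary ones it does not. *)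
definition root_family ::
  "('k::rc_field \<Rightarrow> 'h::banach \<Rightarrow> 'h) \<Rightarrow> ('h \<Rightarrow> 'h \<Rightarrow> 'k) \<Rightarrow> ('h \<Rightarrow> 'h) \<Rightarrow> ('h \<Rightarrow> 'h)
    \<Rightarrow> 'i set \<Rightarrow> ('i \<Rightarrow> 'h set) \<Rightarrow> ('i \<Rightarrow> real) \<Rightarrow> ('i \<Rightarrow> 'h \<Rightarrow> 'h) \<Rightarrow> bool" where
  "root_family smul ip C C' I W v R \<longleftrightarrow>
     (\<forall>i\<in>I. bounded_op smul (R i) \<and>
        R i \<circ> R i = adjoint_on UNIV ip ip C \<circ> orth_proj ip (W i) \<circ> C') \<and>
     K2 I v R \<subseteq> ell2 I"

(* The Hilbert space adjoint of the analysis operator. On K2 it is given by the frame operator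
   series sum_i v_i^2 C* pi_{W i} C' f when the roots are self-adjoint. *)
definition synthesis_op ::
  "('h::banach \<Rightarrow> 'h \<Rightarrow> 'k::rc_field) \<Rightarrow> 'i set \<Rightarrow> ('i \<Rightarrow> real) \<Rightarrow> ('i \<Rightarrow> 'h \<Rightarrow> 'h)
    \<Rightarrow> ('i \<Rightarrow> 'h) \<Rightarrow> 'h" where
  "synthesis_op ip I v R = adjoint_on UNIV ip (ell2_ip ip I) (analysis_op I v R)"

definition Q_dual ::
  "('k::rc_field \<Rightarrow> 'h::banach \<Rightarrow> 'h) \<Rightarrow> ('h \<Rightarrow> 'h \<Rightarrow> 'k) \<Rightarrow> ('h \<Rightarrow> 'h) \<Rightarrow> ('h \<Rightarrow> 'h) \<Rightarrow> 'i set
    \<Rightarrow> ('i \<Rightarrow> real) \<Rightarrow> ('i \<Rightarrow> 'h \<Rightarrow> 'h)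
    \<Rightarrow> ('i \<Rightarrow> 'h set) \<Rightarrow> ('i \<Rightarrow> real) \<Rightarrow> ('i \<Rightarrow> 'h \<Rightarrow> 'h) \<Rightarrow> bool" where
  "Q_dual smul ip C C' I v R Wt z Rt \<longleftrightarrow>
     controlled_Bessel_fusion_sequence smul ip C C' I Wt z \<and>
     (\<exists>Q. ell2_bounded_op smul I (K2 I z Rt) (K2 I v R) Q \<and>
        synthesis_op ip I v R \<circ> Q \<circ> analysis_op I z Rt = id)"

end

theory Submission
  imports Defs
begin

text \<open>All three conditions say that the form \<open>\<langle>Q (Tt f), T g\<rangle>\<close> equals \<open>\<langle>f, g\<rangle>\<close>, once the three
  adjoints are known to exist. The analysis operators are bounded by the uniform boundedness
  principle, so their adjoints exist by the Riesz theorem. For \<open>Q\<close> the adjoint has to take values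
  in \<open>K2 I z Rt\<close>, which must therefore be complete: duality provides a bounded left inverse of \<open>Tt\<close>,
  so \<open>Tt\<close> is bounded below, and \<open>\<langle>Tt f, Tt g\<rangle>\<close> is an equivalent inner product on \<open>H\<close> to which the
  Riesz theorem applies as well.\<close>

section \<open>Scalar conjugation and Hermitian forms over \<open>rc_field\<close>\<close>

lemma sconj_zero [simp]: "sconj (0::'k::rc_field) = 0"
  using conj_add[of 0 "0::'k"] by simp

text \<open>A consequence of \<open>mult_conj\<close>: both \<open>of_real r\<close> and its
  conjugate give the same product with \<open>of_real r\<close>, which cancels unless it is
  zero.\<close>

lemma sconj_of_real [simp]: "sconj (of_real r :: 'k::rc_field) = of_real r"
proof (cases "r = 0")
  case False
  have "of_real r * sconj (of_real r :: 'k) = of_real r * of_real r"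
    by (simp add: mult_conj scaleR_conv_of_real power2_eq_square)
  with False show ?thesis by simp
qed simp

lemma sconj_mult_self: "sconj a * a = (of_real (norm (a::'k::rc_field)))\<^sup>2"
  using mult_conj[of a] by (simp add: scaleR_conv_of_real mult.commute)

lemma norm_sconj [simp]: "norm (sconj (a::'k::rc_field)) = norm a"
proof (cases "a = 0")
  case False
  have "norm a * norm (sconj a) = norm a * norm a"
    by (simp add: norm_mult[symmetric] mult_conj) (simp add: norm_mult power2_eq_square)
  with False show ?thesis by simp
qed simp

text \<open>Continuity is what lets conjugation pass through the infinite sum in
  \<open>ell2_ip_commute\<close>.\<close>

lemma bounded_linear_sconj: "bounded_linear (sconj :: 'k::rc_field \<Rightarrow> 'k)"
  by (rule bounded_linear_intro[where K = 1])
     (simp_all add: conj_add conj_mult scaleR_conv_of_real)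

text \<open>One locale for two forms on the Hilbert space: \<open>ip\<close> itself, and later
  \<open>ell2_ip ip I (T f) (T g)\<close>. \<open>N\<close> is the real quadratic form on the
  diagonal.\<close>

locale psd_form = vector_space smul
  for smul :: "'k::rc_field \<Rightarrow> 'h::ab_group_add \<Rightarrow> 'h" +
  fixes a :: "'h \<Rightarrow> 'h \<Rightarrow> 'k" and N :: "'h \<Rightarrow> real"
  assumes add_left: "a (x + y) u = a x u + a y u"
    and smul_left: "a (smul c x) u = c * a x u"
    and commute: "a x u = sconj (a u x)"
    and self: "a x x = of_real (N x)"
begin

lemma minus_left: "a (- x) u = - a x u"
  using smul_left[of "-1" x u] by simp

lemma diff_left: "a (x - y) u = a x u - a y u"
  using add_left[of x "- y" u] by (simp add: minus_left)

lemma add_right: "a u (x + y) = a u x + a u y"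
  by (subst (1 2 3) commute) (simp add: add_left conj_add)

lemma smul_right: "a u (smul c x) = sconj c * a u x"
  by (subst (1 2) commute) (simp add: smul_left conj_mult)

lemma minus_right: "a u (- x) = - a u x"
  using smul_right[of u "-1" x] sconj_of_real[of "-1", where 'k = 'k] by simp

lemma diff_right: "a u (x - y) = a u x - a u y"
  using add_right[of u x "- y"] by (simp add: minus_right)

lemma parallelogram: "N (x + y) + N (x - y) = 2 * N x + 2 * N y"
proof -
  have "of_real (N (x + y) + N (x - y)) = (of_real (2 * N x + 2 * N y) :: 'k)"
    unfolding of_real_add of_real_mult self[symmetric]
    by (simp add: add_left add_right diff_left diff_right)
  then show ?thesis by (simp only: of_real_eq_iff)
qed

lemma N_smul: "N (smul c x) = (norm c)\<^sup>2 * N x"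
proof -
  have "of_real (N (smul c x)) = (of_real ((norm c)\<^sup>2 * N x) :: 'k)"
    unfolding of_real_mult self[symmetric]
    by (simp add: smul_left smul_right mult.assoc[symmetric] sconj_mult_self)
  then show ?thesis by (simp only: of_real_eq_iff)
qed

text \<open>Pythagoras for the residual of \<open>x\<close> after projection onto the line through
  \<open>y\<close>. It yields both the Cauchy-Schwarz inequality and the orthogonality step of the
  Riesz theorem.\<close>

lemma N_diff_component:
  assumes "N y \<noteq> 0"
  shows "N (x - smul (a x y / of_real (N y)) y) = N x - (norm (a x y))\<^sup>2 / N y"
proof -
  let ?t = "a x y / of_real (N y)"
  have m: "a x y * a y x = of_real ((norm (a x y))\<^sup>2)"
    using mult_conj[of "a x y"] commute[of y x] by (simp add: scaleR_conv_of_real)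
  have "(of_real (N (x - smul ?t y)) :: 'k)
      = a x x - ?t * a y x - sconj ?t * (a x y - ?t * a y y)"
    unfolding self[symmetric]
    by (simp add: diff_left diff_right smul_left smul_right)
  \<comment> \<open>With the projection coefficient \<open>?t\<close> the residual is orthogonal to
    \<open>y\<close>, so the bracket after \<open>sconj ?t\<close> vanishes.\<close>
  also have "\<dots> = of_real (N x) - a x y * a y x / of_real (N y)"
    using assms by (simp add: self)
  also have "\<dots> = of_real (N x - (norm (a x y))\<^sup>2 / N y)"
    unfolding m by simp
  finally show ?thesis by (simp only: of_real_eq_iff)
qed

end

section \<open>The Riesz theorem for bounded coercive forms\<close>

locale hermitian_form = psd_form smul a N
  for smul :: "'k::rc_field \<Rightarrow> 'h::banach \<Rightarrow> 'h" and a :: "'h \<Rightarrow> 'h \<Rightarrow> 'k" and N +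
  fixes M c :: real
  assumes smul_of_real: "smul (of_real r) x = r *\<^sub>R x"
    and bounded: "norm (a x y) \<le> M * norm x * norm y"
    and coercive: "c * (norm x)\<^sup>2 \<le> N x" and c_pos: "0 < c"
begin

lemma N_nonneg: "0 \<le> N x"
  using coercive[of x] c_pos by (meson less_imp_le mult_nonneg_nonneg order_trans zero_le_power2)

lemma N_pos: "x \<noteq> 0 \<Longrightarrow> 0 < N x"
  using coercive[of x] c_pos by (smt (verit) mult_pos_pos zero_less_norm_iff zero_less_power)

lemma bounded_linear_left: "bounded_linear (\<lambda>x. a x y)"
proof (rule bounded_linear_intro)
  show "a (r *\<^sub>R x) y = r *\<^sub>R a x y" for r x
    by (simp add: smul_of_real[symmetric] smul_left scaleR_conv_of_real)
  show "norm (a x y) \<le> norm x * (M * norm y)" for x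
    using bounded[of x y] by (simp add: mult_ac)
qed (rule add_left)

text \<open>Coercivity makes \<open>N\<close> control the norm, so a sequence minimising
  \<open>N\<close> on the hyperplane \<open>\<phi> x = 1\<close> is Cauchy in norm and completeness
  of the space supplies its limit.\<close>

theorem Riesz:
  assumes \<phi>: "bounded_linear \<phi>" and \<phi>_smul: "\<And>t x. \<phi> (smul t x) = t * \<phi> x"
  obtains y where "\<And>x. \<phi> x = a x y"
proof (cases "\<forall>x. \<phi> x = 0")
  case True
  have "\<phi> x = a x 0" for x
    using True smul_right[of x 0 0] by simp
  then show ?thesis by (rule that)
next
  case False
  interpret \<phi>: bounded_linear \<phi> by (rule \<phi>)
  \<comment> \<open>A minimiser of \<open>N\<close> on \<open>S\<close> is orthogonal to the kernel of \<open>\<phi>\<close>.\<close>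
  define S where "S = {x. \<phi> x = 1}"
  define d where "d = (INF x\<in>S. N x)"
  from False obtain x0 where "\<phi> x0 \<noteq> 0" by blast
  then have "smul (inverse (\<phi> x0)) x0 \<in> S" by (simp add: S_def \<phi>_smul)
  then have S_ne: "S \<noteq> {}" by blast
  have bdd: "bdd_below (N ` S)"
    by (rule bdd_belowI2[of _ 0]) (rule N_nonneg)
  have d_le: "d \<le> N x" if "x \<in> S" for x
    unfolding d_def using bdd that by (rule cINF_lower)
  have "\<exists>x\<in>S. N x < d + inverse (Suc n)" for n
    using cINF_less_iff[OF S_ne bdd, of "d + inverse (Suc n)"] by (simp add: d_def)
  then obtain X where X: "\<And>n. X n \<in> S" and X_lt: "\<And>n. N (X n) < d + inverse (Suc n)"
    by metis
  \<comment> \<open>The midpoint of \<open>x\<close> and \<open>y\<close> lies in \<open>S\<close>,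
    so \<open>N (x + y)\<close> is at least \<open>4 * d\<close>; the parallelogram law then bounds
    \<open>N (x - y)\<close>.\<close>
  have dist: "c * (norm (x - y))\<^sup>2 \<le> 2 * (N x - d) + 2 * (N y - d)" if "x \<in> S" "y \<in> S" for x y
  proof -
    have "smul (of_real (1/2)) (x + y) \<in> S"
      using that by (simp only: S_def mem_Collect_eq \<phi>_smul \<phi>.add) simp
    then have "4 * d \<le> N (x + y)"
      using d_le by (fastforce simp: N_smul power2_eq_square)
    then show ?thesis
      using coercive[of "x - y"] parallelogram[of x y] by simp
  qed
  have "Cauchy X"
  proof (rule CauchyI)
    fix e :: real assume e: "0 < e"
    \<comment> \<open>Chosen so that the two excesses over \<open>d\<close>, each below
      \<open>q\<close> and counted twice in \<open>dist\<close>, add up to less than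
      \<open>c * e\<^sup>2\<close>.\<close>
    define q where "q = c * e\<^sup>2 / 4"
    have "0 < q" using c_pos e by (simp add: q_def)
    then obtain n0 where n0: "inverse (Suc n0) < q"
      using reals_Archimedean by blast
    have lt: "N (X n) - d < q" if "n0 \<le> n" for n
    proof -
      have "inverse (real (Suc n)) \<le> inverse (Suc n0)"
        using that by (intro le_imp_inverse_le) auto
      then show ?thesis using X_lt[of n] n0 by linarith
    qed
    have "norm (X m - X n) < e" if "n0 \<le> m" "n0 \<le> n" for m n
    proof -
      note dist[OF X X, of m n]
      also have "2 * (N (X m) - d) + 2 * (N (X n) - d) < 4 * q"
        using lt[OF that(1)] lt[OF that(2)] by simp
      finally have "c * (norm (X m - X n))\<^sup>2 < 4 * q" .
      then show ?thesis
        using c_pos e by (simp add: q_def power_less_imp_less_base)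
    qed
    then show "\<exists>k. \<forall>m\<ge>k. \<forall>n\<ge>k. norm (X m - X n) < e" by blast
  qed
  then obtain y where y: "X \<longlonglongrightarrow> y"
    using Cauchy_convergent_iff convergent_def by blast
  have "(\<lambda>n. \<phi> (X n)) \<longlonglongrightarrow> \<phi> y" using y by (rule \<phi>.tendsto)
  moreover have "(\<lambda>n. \<phi> (X n)) = (\<lambda>n. 1)" using X by (simp add: S_def)
  ultimately have \<phi>y: "\<phi> y = 1"
    by (simp add: LIMSEQ_const_iff)
  then have "y \<noteq> 0" by (auto simp: \<phi>.zero)
  from N_pos[OF this] have Ny: "N y \<noteq> 0" by simp
  \<comment> \<open>Moving \<open>X n\<close> along \<open>x\<close> stays in \<open>S\<close> and
    lowers \<open>N\<close> by at most the excess \<open>N (X n) - d\<close>. The estimate is made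
    for each \<open>X n\<close> and passed to the limit, which uses continuity of the form in its
    first argument only.\<close>
  have orth: "a y x = 0" if "\<phi> x = 0" for x
  proof (cases "x = 0")
    case True
    then show ?thesis using smul_right[of y 0 0] by simp
  next
    case False
    note Nx = N_pos[OF False]
    have "(\<lambda>n. a (X n) x) \<longlonglongrightarrow> a y x"
      using bounded_linear.tendsto[OF bounded_linear_left y] .
    then have "(\<lambda>n. (norm (a (X n) x))\<^sup>2) \<longlonglongrightarrow> (norm (a y x))\<^sup>2"
      by (intro tendsto_intros)
    moreover have "(norm (a (X n) x))\<^sup>2 \<le> inverse (Suc n) * N x" for n
    proof -
      have "X n - smul (a (X n) x / of_real (N x)) x \<in> S"
        using X[of n] that by (simp add: S_def \<phi>.diff \<phi>_smul)
      from d_le[OF this] have "(norm (a (X n) x))\<^sup>2 / N x \<le> inverse (Suc n)"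
        using N_diff_component[of x "X n"] Nx X_lt[of n] by linarith
      then show ?thesis using Nx by (simp add: pos_divide_le_eq)
    qed
    moreover have "(\<lambda>n. inverse (real (Suc n)) * N x) \<longlonglongrightarrow> 0 * N x"
      by (intro tendsto_intros LIMSEQ_inverse_real_of_nat)
    ultimately have "(norm (a y x))\<^sup>2 \<le> 0"
      using LIMSEQ_le by (metis (no_types, lifting) mult_zero_left)
    then show ?thesis by simp
  qed
  \<comment> \<open>Since \<open>\<phi> y = 1\<close>, the vector
    \<open>x - smul (\<phi> x) y\<close> lies in the kernel, hence is orthogonal to
    \<open>y\<close>. So \<open>a x y\<close> is \<open>\<phi> x\<close> times \<open>N y\<close>,
    and the real factor \<open>1 / N y\<close> passes unchanged through the conjugation of the
    second argument.\<close>
  have "\<phi> x = a x (smul (of_real (1 / N y)) y)" for x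
  proof -
    have "a y (x - smul (\<phi> x) y) = 0"
      by (rule orth) (simp add: \<phi>.diff \<phi>_smul \<phi>y)
    then have "a (x - smul (\<phi> x) y) y = 0"
      by (subst commute) simp
    then show ?thesis
      using Ny by (simp add: diff_left smul_left smul_right self del: of_real_divide)
        (simp add: field_simps)
  qed
  then show ?thesis by (rule that)
qed

end

section \<open>The uniform boundedness principle for families of seminorms\<close>

lemma uniform_boundedness:
  fixes p :: "'j \<Rightarrow> 'a::banach \<Rightarrow> real"
  assumes cont: "\<And>j. continuous_on UNIV (p j)"
    and triangle: "\<And>j x y. p j (x + y) \<le> p j x + p j y"
    and scale: "\<And>j r x. p j (r *\<^sub>R x) = \<bar>r\<bar> * p j x"
    and pointwise: "\<And>x. \<exists>b. \<forall>j. p j x \<le> b"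
  obtains M where "0 < M" "\<And>j x. p j x \<le> M * norm x"
proof -
  \<comment> \<open>These closed sets cover the space by the pointwise bounds, so by Baire one of
    them has an interior point.\<close>
  define E where "E n = {x. \<forall>j. p j x \<le> real n}" for n
  have closed: "closed (E n)" for n
    unfolding E_def by (intro closed_Collect_all closed_Collect_le cont continuous_on_const)
  have "x \<in> \<Union> (range E)" for x
  proof -
    obtain b where "\<forall>j. p j x \<le> b" using pointwise by blast
    then have "\<forall>j. p j x \<le> real (nat \<lceil>b\<rceil>)"
      using real_nat_ceiling_ge order_trans by blast
    then show ?thesis by (auto simp: E_def)
  qed
  then have UN: "\<Union> (range E) = UNIV" by blast
  have "\<exists>n. interior (E n) \<noteq> {}"
  proof (rule ccontr)
    assume "\<nexists>n. interior (E n) \<noteq> {}"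
    then have "euclidean interior_of \<Union> (range E) = {}"
      using closed
      by (intro Baire_category_alt) (auto simp: completely_metrizable_space_euclidean)
    then show False unfolding UN by simp
  qed
  then obtain n x0 where "x0 \<in> interior (E n)" by blast
  then obtain e where e: "0 < e" "cball x0 e \<subseteq> E n"
    by (auto simp: mem_interior_cball)
  \<comment> \<open>Write \<open>h\<close> as the difference of \<open>x0 + h\<close> and
    \<open>x0\<close>, both in \<open>E n\<close>; homogeneity at \<open>-1\<close> handles the
    sign, and each term costs \<open>real n\<close>.\<close>
  have small: "p j h \<le> 2 * real n" if "norm h \<le> e" for j h
  proof -
    have "x0 + h \<in> E n" "x0 \<in> E n"
      using e that by (auto simp: subset_iff dist_norm)
    then have "p j (x0 + h) \<le> real n" "p j ((-1) *\<^sub>R x0) \<le> real n"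
      unfolding scale by (simp_all add: E_def)
    then show ?thesis using triangle[of j "x0 + h" "(-1) *\<^sub>R x0"] by simp
  qed
  \<comment> \<open>Rescaling to norm \<open>e\<close> gives the factor
    \<open>2 * real n / e\<close>; the \<open>+ 1\<close> keeps the constant positive even when
    \<open>n = 0\<close>.\<close>
  have "p j x \<le> (2 * real n / e + 1) * norm x" for j x
  proof (cases "x = 0")
    case True
    then show ?thesis using scale[of j 0 x] by simp
  next
    case False
    have "p j ((e / norm x) *\<^sub>R x) \<le> 2 * real n"
      by (rule small) (use False e in simp)
    then have "p j x \<le> 2 * real n / e * norm x"
      unfolding scale using False e by (simp add: field_simps)
    also have "\<dots> \<le> (2 * real n / e + 1) * norm x" by (simp add: distrib_right)
    finally show ?thesis .
  qed
  moreover have "0 < 2 * real n / e + 1" using e by (simp add: add_nonneg_pos)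
  ultimately show ?thesis using that by blast
qed


section \<open>Norm estimates for square-summable families\<close>

lemma ell2_summable: "x \<in> ell2 I \<Longrightarrow> (\<lambda>i. (norm (x i))\<^sup>2) summable_on I"
  by (simp add: ell2_def)

lemma ell2_norm_nonneg: "0 \<le> ell2_norm I x"
  by (simp add: ell2_norm_def infsum_nonneg)

lemma ell2_norm_power2: "(ell2_norm I x)\<^sup>2 = (\<Sum>\<^sub>\<infinity>i\<in>I. (norm (x i))\<^sup>2)"
  by (simp add: ell2_norm_def infsum_nonneg)

lemma L2_set_le_ell2_norm:
  assumes "x \<in> ell2 I" "finite F" "F \<subseteq> I"
  shows "L2_set (\<lambda>i. norm (x i)) F \<le> ell2_norm I x"
  unfolding L2_set_def ell2_norm_def
  by (intro real_sqrt_le_mono finite_sum_le_infsum ell2_summable assms) simp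

text \<open>Passes from a bound uniform over finite sections, the form in which uniform boundedness
  delivers it, to the full norm.\<close>

lemma ell2_norm_le:
  assumes "x \<in> ell2 I" "0 \<le> b"
    and le: "\<And>F. finite F \<Longrightarrow> F \<subseteq> I \<Longrightarrow> L2_set (\<lambda>i. norm (x i)) F \<le> b"
  shows "ell2_norm I x \<le> b"
proof -
  have "(\<Sum>i\<in>F. (norm (x i))\<^sup>2) \<le> b\<^sup>2" if "finite F" "F \<subseteq> I" for F
    using power_mono[OF le[OF that], of 2] by (simp add: L2_set_def sum_nonneg)
  then have "(ell2_norm I x)\<^sup>2 \<le> b\<^sup>2"
    unfolding ell2_norm_power2 by (intro infsum_le_finite_sums ell2_summable assms)
  then show ?thesis using assms by (simp add: power2_le_iff_abs_le)
qed

text \<open>Cauchy-Schwarz on finite sections bounds all partial sums of a nonnegative family, which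
  gives summability and the estimate together.\<close>

lemma ell2_mult:
  assumes "x \<in> ell2 I" "y \<in> ell2 I"
  shows "(\<lambda>i. norm (x i) * norm (y i)) summable_on I"
    and "(\<Sum>\<^sub>\<infinity>i\<in>I. norm (x i) * norm (y i)) \<le> ell2_norm I x * ell2_norm I y"
proof -
  have le: "(\<Sum>i\<in>F. norm (x i) * norm (y i)) \<le> ell2_norm I x * ell2_norm I y"
    if "finite F" "F \<subseteq> I" for F
  proof -
    have "(\<Sum>i\<in>F. norm (x i) * norm (y i))
        \<le> L2_set (\<lambda>i. norm (x i)) F * L2_set (\<lambda>i. norm (y i)) F"
      using L2_set_mult_ineq[of "\<lambda>i. norm (x i)" "\<lambda>i. norm (y i)" F] by simp
    also have "\<dots> \<le> ell2_norm I x * ell2_norm I y"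
      by (intro mult_mono L2_set_le_ell2_norm assms that ell2_norm_nonneg L2_set_nonneg)
    finally show ?thesis .
  qed
  show summable: "(\<lambda>i. norm (x i) * norm (y i)) summable_on I"
    by (rule nonneg_bdd_above_summable_on) (auto intro!: bdd_aboveI2 le)
  show "(\<Sum>\<^sub>\<infinity>i\<in>I. norm (x i) * norm (y i)) \<le> ell2_norm I x * ell2_norm I y"
    by (rule infsum_le_finite_sums[OF summable le])
qed

section \<open>The inner product of square-summable families\<close>

sublocale hilbert_space \<subseteq> psd_form smul ip "\<lambda>x. (norm x)\<^sup>2"
  by unfold_locales (rule ip_add_left ip_smul_left ip_commute ip_self)+

context hilbert_space
begin

text \<open>Cauchy-Schwarz: the residual in \<open>N_diff_component\<close> has nonnegative squared
  norm.\<close>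

lemma norm_ip_le: "norm (ip x y) \<le> norm x * norm y"
proof (cases "y = 0")
  case True
  then show ?thesis using smul_right[of x 0 0] by simp
next
  case False
  have "0 \<le> (norm x)\<^sup>2 - (norm (ip x y))\<^sup>2 / (norm y)\<^sup>2"
    using N_diff_component[of y x] False by (metis power_not_zero norm_eq_zero zero_le_power2)
  then have "(norm (ip x y))\<^sup>2 \<le> (norm x * norm y)\<^sup>2"
    using False by (simp add: pos_divide_le_eq power_mult_distrib)
  then show ?thesis by (rule power2_le_imp_le) simp
qed

lemma hermitian_form_ip: "hermitian_form smul ip (\<lambda>x. (norm x)\<^sup>2) 1 1"
  by unfold_locales (simp_all add: smul_of_real norm_ip_le)

lemma scaleR_smul: "r *\<^sub>R smul c x = smul c (r *\<^sub>R x)"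
  by (simp add: smul_of_real[symmetric] scale_left_commute)

lemma ell2_ip_abs_summable:
  assumes "x \<in> ell2 I" "y \<in> ell2 I"
  shows "(\<lambda>i. ip (x i) (y i)) abs_summable_on I"
  by (rule summable_on_comparison_test[OF ell2_mult(1)[OF assms]]) (simp_all add: norm_ip_le)

lemma ell2_ip_summable:
  "x \<in> ell2 I \<Longrightarrow> y \<in> ell2 I \<Longrightarrow> (\<lambda>i. ip (x i) (y i)) summable_on I"
  by (rule abs_summable_summable[OF ell2_ip_abs_summable])

lemma norm_ell2_ip_le:
  assumes "x \<in> ell2 I" "y \<in> ell2 I"
  shows "norm (ell2_ip ip I x y) \<le> ell2_norm I x * ell2_norm I y"
proof -
  have "norm (ell2_ip ip I x y) \<le> (\<Sum>\<^sub>\<infinity>i\<in>I. norm (ip (x i) (y i)))"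
    unfolding ell2_ip_def by (rule norm_infsum_bound[OF ell2_ip_abs_summable[OF assms]])
  also have "\<dots> \<le> (\<Sum>\<^sub>\<infinity>i\<in>I. norm (x i) * norm (y i))"
    by (intro infsum_mono ell2_ip_abs_summable ell2_mult assms norm_ip_le)
  also have "\<dots> \<le> ell2_norm I x * ell2_norm I y" by (rule ell2_mult(2)[OF assms])
  finally show ?thesis .
qed

lemma ell2_ip_add_left:
  assumes "x \<in> ell2 I" "y \<in> ell2 I" "u \<in> ell2 I"
  shows "ell2_ip ip I (\<lambda>i. x i + y i) u = ell2_ip ip I x u + ell2_ip ip I y u"
  unfolding ell2_ip_def ip_add_left by (intro infsum_add ell2_ip_summable assms)

text \<open>Valid for all families: when the sum on the right diverges, both sides take the default
  value \<open>0\<close> of \<open>infsum\<close>.\<close>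

lemma ell2_ip_smul_left: "ell2_ip ip I (\<lambda>i. smul c (x i)) u = c * ell2_ip ip I x u"
  unfolding ell2_ip_def ip_smul_left by (rule infsum_cmult_right')

lemma ell2_ip_commute:
  assumes "x \<in> ell2 I" "y \<in> ell2 I"
  shows "ell2_ip ip I x y = sconj (ell2_ip ip I y x)"
proof -
  have "((\<lambda>i. sconj (ip (y i) (x i))) has_sum sconj (ell2_ip ip I y x)) I"
    unfolding ell2_ip_def
    by (rule has_sum_bounded_linear[OF bounded_linear_sconj has_sum_infsum])
      (intro ell2_ip_summable assms)
  then have "((\<lambda>i. ip (x i) (y i)) has_sum sconj (ell2_ip ip I y x)) I"
    by (simp add: ip_commute[symmetric])
  then show ?thesis unfolding ell2_ip_def[of ip I x y] by (rule infsumI)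
qed

lemma ell2_ip_self:
  assumes "x \<in> ell2 I"
  shows "ell2_ip ip I x x = of_real ((ell2_norm I x)\<^sup>2)"
proof -
  have "((\<lambda>i. of_real ((norm (x i))\<^sup>2)) has_sum (of_real ((ell2_norm I x)\<^sup>2) :: 'k)) I"
    unfolding ell2_norm_power2
    by (rule has_sum_bounded_linear[OF bounded_linear_of_real has_sum_infsum])
      (intro ell2_summable assms)
  then show ?thesis unfolding ell2_ip_def ip_self by (rule infsumI)
qed

section \<open>Bounded operators from the Hilbert space into the l2 sum\<close>

definition ell2_map :: "'i set \<Rightarrow> ('h \<Rightarrow> 'i \<Rightarrow> 'h) \<Rightarrow> bool" where
  "ell2_map I T \<longleftrightarrow>
     (\<forall>f. T f \<in> ell2 I) \<and>
     (\<forall>f g. T (f + g) = (\<lambda>i. T f i + T g i)) \<and>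
     (\<forall>c f. T (smul c f) = (\<lambda>i. smul c (T f i))) \<and>
     (\<exists>M>0. \<forall>f. ell2_norm I (T f) \<le> M * norm f)"

lemma ell2_mapD:
  assumes "ell2_map I T"
  shows "T f \<in> ell2 I" "T (f + g) = (\<lambda>i. T f i + T g i)" "T (smul c f) = (\<lambda>i. smul c (T f i))"
  using assms by (auto simp: ell2_map_def)

lemma ell2_map_bound:
  assumes "ell2_map I T"
  obtains M where "0 < M" "\<And>f. ell2_norm I (T f) \<le> M * norm f"
  using assms by (auto simp: ell2_map_def)

text \<open>The inclusion of \<open>K2\<close> in \<open>ell2\<close> gives only finiteness at each
  \<open>f\<close>. Uniform boundedness, applied to the norms of finite sections, turns it into an
  operator bound.\<close>

lemma ell2_map_analysis_op:
  assumes R: "\<And>i. i \<in> I \<Longrightarrow> bounded_op smul (R i)" and sub: "K2 I v R \<subseteq> ell2 I"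
  shows "ell2_map I (analysis_op I v R)"
proof -
  let ?T = "analysis_op I v R"
  have mem: "?T f \<in> ell2 I" for f using sub by (auto simp: K2_def)
  have lin: "bounded_linear (\<lambda>f. ?T f i)" for i
    using R[of i] by (cases "i \<in> I")
      (auto simp: analysis_op_def bounded_op_def bounded_linear_scaleR_const
        intro: bounded_linear_compose[OF bounded_linear_scaleR_right])
  \<comment> \<open>\<open>L2_set\<close> is \<open>0\<close> on infinite sets, so only finite \<open>F \<inter> I\<close> matter.\<close>
  define p where "p F f = L2_set (\<lambda>i. norm (?T f i)) (F \<inter> I)" for F f
  obtain M where M: "0 < M" "\<And>F f. p F f \<le> M * norm f"
  proof (rule uniform_boundedness[of p])
    show "continuous_on UNIV (p F)" for F
      unfolding p_def L2_set_def
      by (intro continuous_intros linear_continuous_on lin)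
    show "p F (f + g) \<le> p F f + p F g" for F f g
    proof -
      have "p F (f + g) \<le> L2_set (\<lambda>i. norm (?T f i) + norm (?T g i)) (F \<inter> I)"
        unfolding p_def bounded_linear.linear[OF lin, THEN linear_add]
        by (intro L2_set_mono norm_triangle_ineq) simp
      also have "\<dots> \<le> p F f + p F g"
        unfolding p_def by (rule L2_set_triangle_ineq)
      finally show ?thesis .
    qed
    show "p F (r *\<^sub>R f) = \<bar>r\<bar> * p F f" for F r f
      unfolding p_def bounded_linear.linear[OF lin, THEN linear_scale]
      by (simp add: L2_set_right_distrib)
    have "p F f \<le> ell2_norm I (?T f)" for F f
    proof (cases "finite (F \<inter> I)")
      case True
      then show ?thesis unfolding p_def by (intro L2_set_le_ell2_norm mem) auto
    qed (simp add: p_def ell2_norm_nonneg)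
    then show "\<exists>b. \<forall>F. p F f \<le> b" for f by blast
  qed blast
  have "ell2_norm I (?T f) \<le> M * norm f" for f
  proof (rule ell2_norm_le[OF mem])
    show "L2_set (\<lambda>i. norm (?T f i)) F \<le> M * norm f" if "F \<subseteq> I" for F
      using M(2)[of F f] that by (simp add: p_def Int_absorb2)
  qed (use M in simp)
  moreover have "?T (f + g) = (\<lambda>i. ?T f i + ?T g i)" for f g
    using bounded_linear.linear[OF lin, THEN linear_add] by blast
  moreover have "?T (smul c f) = (\<lambda>i. smul c (?T f i))" for c f
    using R by (auto simp: analysis_op_def bounded_op_def scaleR_smul)
  ultimately show ?thesis
    unfolding ell2_map_def using mem M(1) by blast
qed

lemma ell2_map_comp:
  assumes T: "ell2_map I T" and Q: "ell2_bounded_op smul I (range T) Y Q" and Y: "Y \<subseteq> ell2 I"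
  shows "ell2_map I (\<lambda>f. Q (T f))"
proof -
  obtain M where M: "0 < M" "\<And>f. ell2_norm I (T f) \<le> M * norm f"
    by (rule ell2_map_bound[OF T]) blast
  obtain K where K: "\<And>x. x \<in> range T \<Longrightarrow> ell2_norm I (Q x) \<le> K * ell2_norm I x"
    using Q unfolding ell2_bounded_op_def by blast
  \<comment> \<open>The constant in \<open>ell2_bounded_op\<close> may have any sign, while
    \<open>ell2_map\<close> asks for a positive one; hence \<open>\<bar>K\<bar> + 1\<close>.\<close>
  have "ell2_norm I (Q (T f)) \<le> ((\<bar>K\<bar> + 1) * M) * norm f" for f
  proof -
    have "ell2_norm I (Q (T f)) \<le> K * ell2_norm I (T f)" by (rule K) simp
    also have "\<dots> \<le> (\<bar>K\<bar> + 1) * (M * norm f)"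
      using M by (intro mult_mono ell2_norm_nonneg) auto
    finally show ?thesis by (simp add: mult.assoc)
  qed
  moreover have "0 < (\<bar>K\<bar> + 1) * M" using M by simp
  ultimately show ?thesis
    unfolding ell2_map_def using Q Y
    by (auto simp: ell2_mapD(2,3)[OF T] ell2_bounded_op_def)
qed

section \<open>Existence of the adjoints\<close>

lemma bounded_linear_ell2_ip_left:
  assumes T: "ell2_map I T" and y: "y \<in> ell2 I"
  shows "bounded_linear (\<lambda>f. ell2_ip ip I (T f) y)"
proof -
  obtain M where M: "0 < M" "\<And>f. ell2_norm I (T f) \<le> M * norm f"
    by (rule ell2_map_bound[OF T]) blast
  show ?thesis
  proof (rule bounded_linear_intro)
    show "ell2_ip ip I (T (f + g)) y = ell2_ip ip I (T f) y + ell2_ip ip I (T g) y" for f g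
      unfolding ell2_mapD(2)[OF T] by (intro ell2_ip_add_left ell2_mapD(1)[OF T] y)
    show "ell2_ip ip I (T (r *\<^sub>R f)) y = r *\<^sub>R ell2_ip ip I (T f) y" for r f
      by (simp add: smul_of_real[symmetric] ell2_mapD(3)[OF T] ell2_ip_smul_left scaleR_conv_of_real)
    show "norm (ell2_ip ip I (T f) y) \<le> norm f * (M * ell2_norm I y)" for f
    proof -
      have "norm (ell2_ip ip I (T f) y) \<le> ell2_norm I (T f) * ell2_norm I y"
        by (intro norm_ell2_ip_le ell2_mapD(1)[OF T] y)
      also have "\<dots> \<le> M * norm f * ell2_norm I y"
        by (intro mult_right_mono M ell2_norm_nonneg)
      finally show ?thesis by (simp add: mult_ac)
    qed
  qed
qed

text \<open>Riesz supplies a representing vector and definiteness of \<open>ip\<close> makes it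
  unique, so the description in \<open>adjoint_on\<close> denotes it.\<close>

lemma adjoint_on_UNIV:
  assumes T: "ell2_map I T" and y: "y \<in> ell2 I"
  shows "ell2_ip ip I (T f) y = ip f (adjoint_on UNIV ip (ell2_ip ip I) T y)"
proof -
  interpret H: hermitian_form smul ip "\<lambda>x. (norm x)\<^sup>2" 1 1 by (rule hermitian_form_ip)
  obtain h where h: "\<And>f. ell2_ip ip I (T f) y = ip f h"
    by (rule H.Riesz[OF bounded_linear_ell2_ip_left[OF T y]])
      (simp_all add: ell2_mapD(3)[OF T] ell2_ip_smul_left)
  have "adjoint_on UNIV ip (ell2_ip ip I) T y = h"
    unfolding adjoint_on_def
  proof (rule the_equality)
    fix h' assume "h' \<in> UNIV \<and> (\<forall>f\<in>UNIV. ell2_ip ip I (T f) y = ip f h')"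
    then have "ip (h' - h) (h' - h) = 0" using h by (simp add: diff_right)
    then show "h' = h" by (simp add: ip_self)
  qed (simp add: h)
  then show ?thesis by (simp add: h)
qed

text \<open>The lower bound on \<open>T\<close> makes the pulled-back form \<open>?a\<close>
  coercive on the whole space. A Riesz vector \<open>g\<close> for \<open>?a\<close> then yields the
  value \<open>T g\<close> of the adjoint, inside \<open>range T\<close>.\<close>

lemma adjoint_on_range:
  assumes T: "ell2_map I T" and QT: "ell2_map I (\<lambda>f. Q (T f))" and y: "y \<in> ell2 I"
    and c: "0 < c" "\<And>f. c * (norm f)\<^sup>2 \<le> (ell2_norm I (T f))\<^sup>2"
  defines "h \<equiv> adjoint_on (range T) (ell2_ip ip I) (ell2_ip ip I) Q y"
  shows "h \<in> range T" "ell2_ip ip I (Q (T f)) y = ell2_ip ip I (T f) h"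
proof -
  let ?a = "\<lambda>f g. ell2_ip ip I (T f) (T g)"
  let ?P = "\<lambda>h. h \<in> range T \<and> (\<forall>x\<in>range T. ell2_ip ip I (Q x) y = ell2_ip ip I x h)"
  note mem = ell2_mapD(1)[OF T]
  obtain M where M: "0 < M" "\<And>f. ell2_norm I (T f) \<le> M * norm f"
    by (rule ell2_map_bound[OF T]) blast
  interpret A: hermitian_form smul ?a "\<lambda>f. (ell2_norm I (T f))\<^sup>2" "M * M" c
  proof unfold_locales
    show "norm (?a f g) \<le> M * M * norm f * norm g" for f g
    proof -
      have "norm (?a f g) \<le> ell2_norm I (T f) * ell2_norm I (T g)"
        by (intro norm_ell2_ip_le mem)
      also have "\<dots> \<le> (M * norm f) * (M * norm g)"
        using M by (intro mult_mono ell2_norm_nonneg) auto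
      finally show ?thesis by (simp add: mult_ac)
    qed
  qed (simp_all add: ell2_mapD(2,3)[OF T] ell2_ip_add_left mem ell2_ip_smul_left
      ell2_ip_self smul_of_real c ell2_ip_commute[OF mem mem, symmetric])
  obtain g where g: "\<And>f. ell2_ip ip I (Q (T f)) y = ?a f g"
    by (rule A.Riesz[OF bounded_linear_ell2_ip_left[OF QT y]])
      (simp_all add: ell2_mapD(3)[OF QT] ell2_ip_smul_left)
  have "?P h"
    unfolding h_def adjoint_on_def
  proof (rule theI[where P = ?P and a = "T g"])
    show "?P (T g)" using g by auto
    \<comment> \<open>Two candidates agree against all of \<open>range T\<close>, in particular
      against \<open>T (g' - g)\<close>, and \<open>?a\<close> is definite.\<close>
    fix h' assume h': "?P h'"
    then obtain g' where g': "h' = T g'" by blast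
    with h' g have "?a (g' - g) (g' - g) = 0"
      unfolding A.diff_right[of "g' - g"] by auto
    then have "g' = g"
      using A.N_pos[of "g' - g"] by (auto simp: ell2_ip_self mem)
    then show "h' = T g" by (simp add: g')
  qed
  then show "h \<in> range T" "ell2_ip ip I (Q (T f)) y = ell2_ip ip I (T f) h" by auto
qed

text \<open>By \<open>inv\<close>, the squared norm of \<open>f\<close> is the inner product of
  \<open>T f\<close> and \<open>Q (Tt f)\<close>. Cauchy-Schwarz and the bounds on \<open>T\<close>
  and \<open>Q\<close> leave one factor \<open>norm f\<close> to cancel.\<close>

lemma coercive_if_left_inverse:
  assumes T: "ell2_map I T" and Tt: "ell2_map I Tt"
    and Q: "ell2_bounded_op smul I (range Tt) (range T) Q"
    and inv: "adjoint_on UNIV ip (ell2_ip ip I) T \<circ> Q \<circ> Tt = id"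
  obtains c where "0 < c" "\<And>f. c * (norm f)\<^sup>2 \<le> (ell2_norm I (Tt f))\<^sup>2"
proof -
  obtain M where M: "0 < M" "\<And>f. ell2_norm I (T f) \<le> M * norm f"
    by (rule ell2_map_bound[OF T]) blast
  obtain K0 where K0: "\<And>x. x \<in> range Tt \<Longrightarrow> ell2_norm I (Q x) \<le> K0 * ell2_norm I x"
    using Q unfolding ell2_bounded_op_def by blast
  define K where "K = \<bar>K0\<bar> + 1"
  have K: "0 < K" by (simp add: K_def)
  have memQ: "Q (Tt f) \<in> ell2 I" for f
  proof -
    have "Q (Tt f) \<in> range T" using Q unfolding ell2_bounded_op_def by blast
    then show ?thesis using ell2_mapD(1)[OF T] by auto
  qed
  have "norm f \<le> M * K * ell2_norm I (Tt f)" for f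
  proof (cases "f = 0")
    case False
    have "of_real ((norm f)\<^sup>2) = ell2_ip ip I (T f) (Q (Tt f))"
      using fun_cong[OF inv, of f] adjoint_on_UNIV[OF T memQ, of f f] by (simp add: ip_self)
    then have "(norm f)\<^sup>2 = norm (ell2_ip ip I (T f) (Q (Tt f)))"
      by (metis norm_of_real abs_of_nonneg zero_le_power2)
    also have "\<dots> \<le> ell2_norm I (T f) * ell2_norm I (Q (Tt f))"
      by (intro norm_ell2_ip_le ell2_mapD(1)[OF T] memQ)
    also have "\<dots> \<le> (M * norm f) * (K * ell2_norm I (Tt f))"
    proof (intro mult_mono M ell2_norm_nonneg)
      have "ell2_norm I (Q (Tt f)) \<le> K0 * ell2_norm I (Tt f)" by (rule K0) simp
      also have "\<dots> \<le> K * ell2_norm I (Tt f)"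
        by (intro mult_right_mono ell2_norm_nonneg) (simp add: K_def)
      finally show "ell2_norm I (Q (Tt f)) \<le> K * ell2_norm I (Tt f)" .
    qed (use M in simp)
    finally have "norm f * norm f \<le> norm f * (M * K * ell2_norm I (Tt f))"
      by (simp add: power2_eq_square mult_ac)
    then show ?thesis using False by simp
  qed (use M K in \<open>simp add: ell2_norm_nonneg\<close>)
  then have "(norm f)\<^sup>2 \<le> (M * K)\<^sup>2 * (ell2_norm I (Tt f))\<^sup>2" for f
    unfolding power_mult_distrib[symmetric] by (intro power_mono) auto
  then have "1 / (M * K)\<^sup>2 * (norm f)\<^sup>2 \<le> (ell2_norm I (Tt f))\<^sup>2" for f
    using M K by (simp add: field_simps)
  then show ?thesis using that[of "1 / (M * K)\<^sup>2"] M K by simp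
qed

text \<open>Testing against \<open>g = S f - f\<close> and using definiteness recovers the operator
  identity from the form identity.\<close>

lemma eq_id_iff_ip: "S = id \<longleftrightarrow> (\<forall>f g. ip f g = ip (S f) g)"
proof
  assume S: "\<forall>f g. ip f g = ip (S f) g"
  have "ip (S f - f) (S f - f) = 0" for f using S by (simp add: diff_left[of "S f" f])
  then show "S = id" by (auto simp: ip_self)
qed simp

end

section \<open>Equivalence of the three duality conditions\<close>

theorem theorem4p1:
  fixes smul :: "'k::rc_field \<Rightarrow> 'h::banach \<Rightarrow> 'h"
    and ip :: "'h \<Rightarrow> 'h \<Rightarrow> 'k"
    and C C' :: "'h \<Rightarrow> 'h"
    and I :: "'i set"
    and W Wt :: "'i \<Rightarrow> 'h set"
    and v z :: "'i \<Rightarrow> real"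
    and R Rt :: "'i \<Rightarrow> 'h \<Rightarrow> 'h"
    and Q :: "('i \<Rightarrow> 'h) \<Rightarrow> ('i \<Rightarrow> 'h)"
  assumes "hilbert_space smul ip"
    and "separable_space (euclidean :: 'h topology)"
    and "C \<in> GL smul" and "C' \<in> GL smul"
    and "controlled_fusion_frame smul ip C C' I W v"
    and "root_family smul ip C C' I W v R"
    and "root_family smul ip C C' I Wt z Rt"
    and "Q_dual smul ip C C' I v R Wt z Rt"
    and "ell2_bounded_op smul I (K2 I z Rt) (K2 I v R) Q"
  shows "let T = analysis_op I v R; Tt = analysis_op I z Rt;
             T_adj = synthesis_op ip I v R; Tt_adj = synthesis_op ip I z Rt;
             Q_adj = adjoint_on (K2 I z Rt) (ell2_ip ip I) (ell2_ip ip I) Q;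
             cond1 = (Tt_adj \<circ> Q_adj \<circ> T = id);
             cond2 = (T_adj \<circ> Q \<circ> Tt = id);
             cond3 = (\<forall>f g. ip f g = ell2_ip ip I (Q_adj (T f)) (Tt g) \<and>
                            ip f g = ell2_ip ip I (Q (Tt f)) (T g))
         in (cond1 \<longleftrightarrow> cond2) \<and> (cond2 \<longleftrightarrow> cond3)"

proof -
  interpret hilbert_space smul ip by fact
  let ?T = "analysis_op I v R" and ?Tt = "analysis_op I z Rt"
  let ?T_adj = "synthesis_op ip I v R" and ?Tt_adj = "synthesis_op ip I z Rt"
  let ?ip = "ell2_ip ip I"
  let ?Q_adj = "adjoint_on (K2 I z Rt) ?ip ?ip Q"
  have T: "ell2_map I ?T" and Tt: "ell2_map I ?Tt"
    using assms(6,7) by (auto simp: root_family_def intro!: ell2_map_analysis_op)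
  note memT = ell2_mapD(1)[OF T] and memTt = ell2_mapD(1)[OF Tt]
  have QTt: "ell2_map I (\<lambda>f. Q (?Tt f))"
    using assms(6,9) by (intro ell2_map_comp[OF Tt]) (auto simp: K2_def root_family_def)
  note memQ = ell2_mapD(1)[OF QTt]
  \<comment> \<open>The operator provided by \<open>Q_dual\<close> is not assumed to be
    \<open>Q\<close>, so the identity for \<open>Q0\<close> must not be read as
    \<open>cond2\<close>. It serves to bound \<open>?Tt\<close> from below.\<close>
  obtain Q0 where "ell2_bounded_op smul I (range ?Tt) (range ?T) Q0"
    and "adjoint_on UNIV ip ?ip ?T \<circ> Q0 \<circ> ?Tt = id"
    using assms(8) by (auto simp: Q_dual_def K2_def synthesis_op_def)
  then obtain c where c: "0 < c" "\<And>f. c * (norm f)\<^sup>2 \<le> (ell2_norm I (?Tt f))\<^sup>2"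
    by (rule coercive_if_left_inverse[OF T Tt]) blast
  have Q_adj: "?ip (Q (?Tt g)) (?T f) = ?ip (?Tt g) (?Q_adj (?T f))"
    and memQ_adj: "?Q_adj (?T f) \<in> ell2 I" for f g
    using adjoint_on_range[OF Tt QTt memT[of f] c] memTt by (auto simp: K2_def)
  \<comment> \<open>\<open>adjoint_on_UNIV\<close> has the adjoint in the second argument, so
    conjugate symmetry is applied once in the Hilbert space and once in the l2 sum.\<close>
  have ip1: "ip ((?Tt_adj \<circ> ?Q_adj \<circ> ?T) f) g = ?ip (?Q_adj (?T f)) (?Tt g)" for f g
    unfolding synthesis_op_def comp_def
    by (subst ip_commute, subst adjoint_on_UNIV[OF Tt memQ_adj, symmetric])
      (rule ell2_ip_commute[OF memQ_adj memTt, symmetric])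
  have ip2: "ip ((?T_adj \<circ> Q \<circ> ?Tt) f) g = ?ip (Q (?Tt f)) (?T g)" for f g
    unfolding synthesis_op_def comp_def
    by (subst ip_commute, subst adjoint_on_UNIV[OF T memQ, symmetric])
      (rule ell2_ip_commute[OF memQ memT, symmetric])
  have swap: "?ip (?Q_adj (?T f)) (?Tt g) = sconj (?ip (Q (?Tt g)) (?T f))" for f g
    unfolding Q_adj by (rule ell2_ip_commute[OF memQ_adj memTt])
  have conj_ip: "ip f g = sconj w \<longleftrightarrow> ip g f = w" for f g w
    by (subst ip_commute) (metis conj_conj)
  \<comment> \<open>By \<open>swap\<close> the two forms are conjugates of each other with
    \<open>f\<close> and \<open>g\<close> exchanged. By \<open>ip1\<close> and \<open>ip2\<close>
    the left side is \<open>cond1\<close> and the right side \<open>cond2\<close>, and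
    \<open>cond3\<close> is their conjunction.\<close>
  have "(\<forall>f g. ip f g = ?ip (?Q_adj (?T f)) (?Tt g)) \<longleftrightarrow> (\<forall>f g. ip f g = ?ip (Q (?Tt f)) (?T g))"
    unfolding swap conj_ip by blast
  then show ?thesis
    unfolding Let_def eq_id_iff_ip ip1 ip2 all_conj_distrib by argo
qed

end
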